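(* Let $P:\mathbb C^{\mathrm{op}}\to\mathbf{Pos}$ be a primary doctrine, $X$ an object of $\mathbb C$ and $\varphi\in P(X)$, and let $P_{(X,\varphi)}$ be the associated Kleisli doctrine with canonical 1-arrow $(F_X,\mathfrak f):P\to P_{(X,\varphi)}$. If $P$ has pseudo-complements, then $P_{(X,\varphi)}$ has pseudo-complements, and $(F_X,\mathfrak f)$ preserves pseudo-complements.
   Context: A doctrine is a functor $P:\mathbb C^{\mathrm{op}}\to\mathbf{Pos}$ with $\mathbb C$ a category with finite products and $\mathbf{Pos}$ the category of posets and monotone maps; the maps $P(f)$ are called reindexings. It is primary if every $P(A)$ has finite meets ($\wedge$, $\top$) and all reindexings preserve them. A 1-arrow (doctrine homomorphism) from $P:\mathbb C^{\mathrm{op}}\to\mathbf{Pos}$ to $R:\mathbb D^{\mathrm{op}}\to\mathbf{Pos}$ is a pair $(F,\mathfrak f)$ with $F:\mathbb C\to\mathbb D$ a finite-product-preserving functor and $\mathfrak f:P\to R\circ F^{\mathrm{op}}$ natural; it is primary if $P,R$ are primary and each $\mathfrak f_A$ preserves finite meets. A primary doctrine $P$ has pseudo-complements if each $P(A)$ has a bottom element $\bot$ and an operation $\neg$ with $\neg a=\max\{b\mid a\wedge b=\bot\}$ for all $a\in P(A)$, and $\bot$ and $\neg:P^{\mathrm{op}}\to P$ are natural (preserved by reindexings). A primary homomorphism between doctrines with pseudo-complements preserves pseudo-complements if it preserves top and bottom elements and $\neg$. Kleisli doctrine (the Kleisli object of the comonad on $P$ given by $X\times-$ and $\alpha\mapsto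 P(\mathrm{pr}_1)(\varphi)\wedge P(\mathrm{pr}_2)(\alpha)$). The category $\mathbb C_X$ has the same objects as $\mathbb C$; an arrow $g:A\rightsquigarrow B$ in $\mathbb C_X$ is a $\mathbb C$-arrow $g:X\times A\to B$; the identity of $A$ is $\mathrm{pr}_2:X\times A\to A$; the composite of $g:A\rightsquigarrow B$ and $h:B\rightsquigarrow C$ is $h\langle\mathrm{pr}_1,g\rangle$. It has finite products, given on objects by those of $\mathbb C$. The doctrine $P_{(X,\varphi)}:\mathbb C_X^{\mathrm{op}}\to\mathbf{Pos}$ has $P_{(X,\varphi)}(A)=\{\alpha\in P(X\times A)\mid\alpha\le P(\mathrm{pr}_1)(\varphi)\}$ with the order of $P(X\times A)$, and reindexing along $g:A\rightsquigarrow B$ is the restriction of $P(\langle\mathrm{pr}_1,g\rangle)$. The 1-arrow $(F_X,\mathfrak f):P\to P_{(X,\varphi)}$: $F_X:\mathbb C\to\mathbb C_X$ is the identity on objects and sends $f:A\to B$ to $f\,\mathrm{pr}_2:A\rightsquigarrow B$; $\mathfrak f_A(\alpha)=P(\mathrm{pr}_1)(\varphi)\wedge P(\mathrm{pr}_2)(\alpha)$, for $\mathrm{pr}_1,\mathrm{pr}_2$ the projections from $X\times A$. *)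

theory Defs
  imports "HOL-Algebra.Lattice"
begin

section \<open>Categories with finite products\<close>

text \<open>
  Categories are given by a family of hom-sets \<open>Hom C A B\<close> that need not be disjoint, so identities
  and composition carry their objects as arguments. This matters for the Kleisli category below,
  where one and the same arrow may belong to several hom-sets and composition depends on the source.
  \<open>Comp C A B D g f\<close> is the composite (first \<open>f : A \<rightarrow> B\<close>, then \<open>g : B \<rightarrow> D\<close>).
\<close>

record ('o, 'm) category_data =
  Obj :: "'o set"
  Hom :: "'o \<Rightarrow> 'o \<Rightarrow> 'm set"
  Ide :: "'o \<Rightarrow> 'm"
  Comp :: "'o \<Rightarrow> 'o \<Rightarrow> 'o \<Rightarrow> 'm \<Rightarrow> 'm \<Rightarrow> 'm"

locale category =
  fixes C :: "('o, 'm, 'x) category_data_scheme"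
  assumes Ide_in_Hom: "A \<in> Obj C \<Longrightarrow> Ide C A \<in> Hom C A A"
    and Comp_in_Hom:
      "\<lbrakk>A \<in> Obj C; B \<in> Obj C; D \<in> Obj C; f \<in> Hom C A B; g \<in> Hom C B D\<rbrakk>
        \<Longrightarrow> Comp C A B D g f \<in> Hom C A D"
    and Comp_Ide_right:
      "\<lbrakk>A \<in> Obj C; B \<in> Obj C; f \<in> Hom C A B\<rbrakk> \<Longrightarrow> Comp C A A B f (Ide C A) = f"
    and Comp_Ide_left:
      "\<lbrakk>A \<in> Obj C; B \<in> Obj C; f \<in> Hom C A B\<rbrakk> \<Longrightarrow> Comp C A B B (Ide C B) f = f"
    and Comp_assoc:
      "\<lbrakk>A \<in> Obj C; B \<in> Obj C; D \<in> Obj C; E \<in> Obj C;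
        f \<in> Hom C A B; g \<in> Hom C B D; h \<in> Hom C D E\<rbrakk>
        \<Longrightarrow> Comp C A D E h (Comp C A B D g f) = Comp C A B E (Comp C B D E h g) f"

definition is_terminal :: "('o, 'm, 'x) category_data_scheme \<Rightarrow> 'o \<Rightarrow> bool" where
  "is_terminal C T \<longleftrightarrow> T \<in> Obj C \<and> (\<forall>Z \<in> Obj C. \<exists>!f. f \<in> Hom C Z T)"

definition is_product ::
  "('o, 'm, 'x) category_data_scheme \<Rightarrow> 'o \<Rightarrow> 'o \<Rightarrow> 'o \<Rightarrow> 'm \<Rightarrow> 'm \<Rightarrow> bool" where
  "is_product C A B Q p q \<longleftrightarrow>
     A \<in> Obj C \<and> B \<in> Obj C \<and> Q \<in> Obj C \<and> p \<in> Hom C Q A \<and> q \<in> Hom C Q B \<and>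
     (\<forall>Z \<in> Obj C. \<forall>f \<in> Hom C Z A. \<forall>g \<in> Hom C Z B.
        \<exists>!h. h \<in> Hom C Z Q \<and> Comp C Z Q A p h = f \<and> Comp C Z Q B q h = g)"

text \<open>The finite products are chosen: the Kleisli construction refers to a specific \<open>X \<times> A\<close>.\<close>

record ('o, 'm) fp_category_data = "('o, 'm) category_data" +
  Trm :: "'o"
  Prd :: "'o \<Rightarrow> 'o \<Rightarrow> 'o"
  pr1 :: "'o \<Rightarrow> 'o \<Rightarrow> 'm"
  pr2 :: "'o \<Rightarrow> 'o \<Rightarrow> 'm"

locale fp_category = category C for C :: "('o, 'm, 'x) fp_category_data_scheme" +
  assumes Trm_terminal: "is_terminal C (Trm C)"
    and Prd_product:
      "\<lbrakk>A \<in> Obj C; B \<in> Obj C\<rbrakk> \<Longrightarrow> is_product C A B (Prd C A B) (pr1 C A B) (pr2 C A B)"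

definition pairing ::
  "('o, 'm, 'x) fp_category_data_scheme \<Rightarrow> 'o \<Rightarrow> 'o \<Rightarrow> 'o \<Rightarrow> 'm \<Rightarrow> 'm \<Rightarrow> 'm" where
  "pairing C Z A B f g =
     (THE h. h \<in> Hom C Z (Prd C A B) \<and>
             Comp C Z (Prd C A B) A (pr1 C A B) h = f \<and>
             Comp C Z (Prd C A B) B (pr2 C A B) h = g)"


section \<open>Doctrines\<close>

text \<open>For \<open>f : A \<rightarrow> B\<close>, the reindexing \<open>Reidx P A B f\<close> maps \<open>Fib P B\<close> to \<open>Fib P A\<close>.\<close>

record ('o, 'm, 'p) doctrine_data =
  Base :: "('o, 'm) fp_category_data"
  Fib :: "'o \<Rightarrow> 'p gorder"
  Reidx :: "'o \<Rightarrow> 'o \<Rightarrow> 'm \<Rightarrow> 'p \<Rightarrow> 'p"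

locale doctrine =
  fixes P :: "('o, 'm, 'p) doctrine_data"
  assumes Base_fp_category: "fp_category (Base P)"
    and Fib_partial_order: "A \<in> Obj (Base P) \<Longrightarrow> partial_order (Fib P A)"
    and Reidx_closed:
      "\<lbrakk>A \<in> Obj (Base P); B \<in> Obj (Base P); f \<in> Hom (Base P) A B\<rbrakk>
        \<Longrightarrow> Reidx P A B f \<in> carrier (Fib P B) \<rightarrow> carrier (Fib P A)"
    and Reidx_isotone:
      "\<lbrakk>A \<in> Obj (Base P); B \<in> Obj (Base P); f \<in> Hom (Base P) A B\<rbrakk>
        \<Longrightarrow> isotone (Fib P B) (Fib P A) (Reidx P A B f)"
    and Reidx_Ide:
      "\<lbrakk>A \<in> Obj (Base P); a \<in> carrier (Fib P A)\<rbrakk> \<Longrightarrow> Reidx P A A (Ide (Base P) A) a = a"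
    and Reidx_Comp:
      "\<lbrakk>A \<in> Obj (Base P); B \<in> Obj (Base P); D \<in> Obj (Base P);
        f \<in> Hom (Base P) A B; g \<in> Hom (Base P) B D; a \<in> carrier (Fib P D)\<rbrakk>
        \<Longrightarrow> Reidx P A D (Comp (Base P) A B D g f) a = Reidx P A B f (Reidx P B D g a)"

locale primary_doctrine = doctrine P for P :: "('o, 'm, 'p) doctrine_data" +
  assumes Fib_top: "A \<in> Obj (Base P) \<Longrightarrow> weak_partial_order_top (Fib P A)"
    and Fib_meet: "A \<in> Obj (Base P) \<Longrightarrow> lower_semilattice (Fib P A)"
    and Reidx_top:
      "\<lbrakk>A \<in> Obj (Base P); B \<in> Obj (Base P); f \<in> Hom (Base P) A B\<rbrakk>
        \<Longrightarrow> Reidx P A B f \<top>\<^bsub>Fib P B\<^esub> = \<top>\<^bsub>Fib P A\<^esub>"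
    and Reidx_meet:
      "\<lbrakk>A \<in> Obj (Base P); B \<in> Obj (Base P); f \<in> Hom (Base P) A B;
        a \<in> carrier (Fib P B); b \<in> carrier (Fib P B)\<rbrakk>
        \<Longrightarrow> Reidx P A B f (a \<sqinter>\<^bsub>Fib P B\<^esub> b) = Reidx P A B f a \<sqinter>\<^bsub>Fib P A\<^esub> Reidx P A B f b"

record ('o, 'm, 'p, 'n, 'k, 'q) one_arrow_data =
  ob_map :: "'o \<Rightarrow> 'n"
  ar_map :: "'o \<Rightarrow> 'o \<Rightarrow> 'm \<Rightarrow> 'k"
  fib_map :: "'o \<Rightarrow> 'p \<Rightarrow> 'q"

locale doctrine_hom = dom: doctrine P + cod: doctrine R
  for P :: "('o, 'm, 'p) doctrine_data" and R :: "('n, 'k, 'q) doctrine_data" +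
  fixes F :: "('o, 'm, 'p, 'n, 'k, 'q) one_arrow_data"
  assumes ob_map_closed: "A \<in> Obj (Base P) \<Longrightarrow> ob_map F A \<in> Obj (Base R)"
    and ar_map_closed:
      "\<lbrakk>A \<in> Obj (Base P); B \<in> Obj (Base P); f \<in> Hom (Base P) A B\<rbrakk>
        \<Longrightarrow> ar_map F A B f \<in> Hom (Base R) (ob_map F A) (ob_map F B)"
    and ar_map_Ide:
      "A \<in> Obj (Base P) \<Longrightarrow> ar_map F A A (Ide (Base P) A) = Ide (Base R) (ob_map F A)"
    and ar_map_Comp:
      "\<lbrakk>A \<in> Obj (Base P); B \<in> Obj (Base P); D \<in> Obj (Base P);
        f \<in> Hom (Base P) A B; g \<in> Hom (Base P) B D\<rbrakk>
        \<Longrightarrow> ar_map F A D (Comp (Base P) A B D g f) =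
            Comp (Base R) (ob_map F A) (ob_map F B) (ob_map F D) (ar_map F B D g) (ar_map F A B f)"
    and preserves_terminal:
      "is_terminal (Base P) T \<Longrightarrow> is_terminal (Base R) (ob_map F T)"
    and preserves_product:
      "is_product (Base P) A B Q p q
        \<Longrightarrow> is_product (Base R) (ob_map F A) (ob_map F B) (ob_map F Q)
              (ar_map F Q A p) (ar_map F Q B q)"
    and fib_map_closed:
      "A \<in> Obj (Base P)
        \<Longrightarrow> fib_map F A \<in> carrier (Fib P A) \<rightarrow> carrier (Fib R (ob_map F A))"
    and fib_map_isotone:
      "A \<in> Obj (Base P) \<Longrightarrow> isotone (Fib P A) (Fib R (ob_map F A)) (fib_map F A)"
    and fib_map_natural:
      "\<lbrakk>A \<in> Obj (Base P); B \<in> Obj (Base P); f \<in> Hom (Base P) A B; b \<in> carrier (Fib P B)\<rbrakk>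
        \<Longrightarrow> fib_map F A (Reidx P A B f b) =
            Reidx R (ob_map F A) (ob_map F B) (ar_map F A B f) (fib_map F B b)"

locale primary_hom = doctrine_hom P R F + dom: primary_doctrine P + cod: primary_doctrine R
  for P :: "('o, 'm, 'p) doctrine_data" and R :: "('n, 'k, 'q) doctrine_data"
    and F :: "('o, 'm, 'p, 'n, 'k, 'q) one_arrow_data" +
  assumes fib_map_top:
      "A \<in> Obj (Base P) \<Longrightarrow> fib_map F A \<top>\<^bsub>Fib P A\<^esub> = \<top>\<^bsub>Fib R (ob_map F A)\<^esub>"
    and fib_map_meet:
      "\<lbrakk>A \<in> Obj (Base P); a \<in> carrier (Fib P A); b \<in> carrier (Fib P A)\<rbrakk>
        \<Longrightarrow> fib_map F A (a \<sqinter>\<^bsub>Fib P A\<^esub> b) = fib_map F A a \<sqinter>\<^bsub>Fib R (ob_map F A)\<^esub> fib_map F A b"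


section \<open>Pseudo-complements\<close>

definition is_pseudo_complement :: "'p gorder \<Rightarrow> 'p \<Rightarrow> 'p \<Rightarrow> bool" where
  "is_pseudo_complement L a c \<longleftrightarrow>
     greatest L c {b \<in> carrier L. a \<sqinter>\<^bsub>L\<^esub> b = \<bottom>\<^bsub>L\<^esub>}"

definition pneg :: "'p gorder \<Rightarrow> 'p \<Rightarrow> 'p" where
  "pneg L a = (THE c. is_pseudo_complement L a c)"

locale pseudo_complemented_doctrine = primary_doctrine P for P :: "('o, 'm, 'p) doctrine_data" +
  assumes Fib_bottom: "A \<in> Obj (Base P) \<Longrightarrow> weak_partial_order_bottom (Fib P A)"
    and pseudo_complement_exists:
      "\<lbrakk>A \<in> Obj (Base P); a \<in> carrier (Fib P A)\<rbrakk> \<Longrightarrow> \<exists>c. is_pseudo_complement (Fib P A) a c"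
    and Reidx_bottom:
      "\<lbrakk>A \<in> Obj (Base P); B \<in> Obj (Base P); f \<in> Hom (Base P) A B\<rbrakk>
        \<Longrightarrow> Reidx P A B f \<bottom>\<^bsub>Fib P B\<^esub> = \<bottom>\<^bsub>Fib P A\<^esub>"
    and Reidx_pneg:
      "\<lbrakk>A \<in> Obj (Base P); B \<in> Obj (Base P); f \<in> Hom (Base P) A B; a \<in> carrier (Fib P B)\<rbrakk>
        \<Longrightarrow> Reidx P A B f (pneg (Fib P B) a) = pneg (Fib P A) (Reidx P A B f a)"

text \<open>Preservation of the top element is part of \<open>primary_hom\<close>.\<close>

locale pseudo_complement_preserving_hom =
    primary_hom P R F + dom: pseudo_complemented_doctrine P + cod: pseudo_complemented_doctrine R
  for P :: "('o, 'm, 'p) doctrine_data" and R :: "('n, 'k, 'q) doctrine_data"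
    and F :: "('o, 'm, 'p, 'n, 'k, 'q) one_arrow_data" +
  assumes fib_map_bottom:
      "A \<in> Obj (Base P) \<Longrightarrow> fib_map F A \<bottom>\<^bsub>Fib P A\<^esub> = \<bottom>\<^bsub>Fib R (ob_map F A)\<^esub>"
    and fib_map_pneg:
      "\<lbrakk>A \<in> Obj (Base P); a \<in> carrier (Fib P A)\<rbrakk>
        \<Longrightarrow> fib_map F A (pneg (Fib P A) a) = pneg (Fib R (ob_map F A)) (fib_map F A a)"


section \<open>The Kleisli doctrine\<close>

text \<open>The product of \<open>A\<close> and \<open>B\<close> in the Kleisli category is \<open>A \<times> B\<close> with the projections
  \<open>X \<times> (A \<times> B) \<rightarrow> A \<times> B \<rightarrow> A\<close> and \<open>X \<times> (A \<times> B) \<rightarrow> A \<times> B \<rightarrow> B\<close>.\<close>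

definition kleisli_lift ::
  "('o, 'm) fp_category_data \<Rightarrow> 'o \<Rightarrow> 'o \<Rightarrow> 'o \<Rightarrow> 'm \<Rightarrow> 'm" where
  "kleisli_lift C X A B g = pairing C (Prd C X A) X B (pr1 C X A) g"

definition kleisli_category :: "('o, 'm) fp_category_data \<Rightarrow> 'o \<Rightarrow> ('o, 'm) fp_category_data" where
  "kleisli_category C X =
     \<lparr> Obj = Obj C,
       Hom = (\<lambda>A B. Hom C (Prd C X A) B),
       Ide = (\<lambda>A. pr2 C X A),
       Comp = (\<lambda>A B D h g. Comp C (Prd C X A) (Prd C X B) D h (kleisli_lift C X A B g)),
       Trm = Trm C,
       Prd = Prd C,
       pr1 = (\<lambda>A B. Comp C (Prd C X (Prd C A B)) (Prd C A B) A
                      (pr1 C A B) (pr2 C X (Prd C A B))),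
       pr2 = (\<lambda>A B. Comp C (Prd C X (Prd C A B)) (Prd C A B) B
                      (pr2 C A B) (pr2 C X (Prd C A B))) \<rparr>"

definition weaken1 :: "('o, 'm, 'p) doctrine_data \<Rightarrow> 'o \<Rightarrow> 'p \<Rightarrow> 'o \<Rightarrow> 'p" where
  "weaken1 P X \<phi> A = Reidx P (Prd (Base P) X A) X (pr1 (Base P) X A) \<phi>"

definition kleisli_doctrine ::
  "('o, 'm, 'p) doctrine_data \<Rightarrow> 'o \<Rightarrow> 'p \<Rightarrow> ('o, 'm, 'p) doctrine_data" where
  "kleisli_doctrine P X \<phi> =
     (let C = Base P in
     \<lparr> Base = kleisli_category C X,
       Fib = (\<lambda>A. (Fib P (Prd C X A))
               \<lparr> carrier := {\<alpha> \<in> carrier (Fib P (Prd C X A)).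
                              \<alpha> \<sqsubseteq>\<^bsub>Fib P (Prd C X A)\<^esub> weaken1 P X \<phi> A} \<rparr>),
       Reidx = (\<lambda>A B g. Reidx P (Prd C X A) (Prd C X B) (kleisli_lift C X A B g)) \<rparr>)"

definition kleisli_arrow ::
  "('o, 'm, 'p) doctrine_data \<Rightarrow> 'o \<Rightarrow> 'p \<Rightarrow> ('o, 'm, 'p, 'o, 'm, 'p) one_arrow_data" where
  "kleisli_arrow P X \<phi> =
     (let C = Base P in
     \<lparr> ob_map = (\<lambda>A. A),
       ar_map = (\<lambda>A B f. Comp C (Prd C X A) A B f (pr2 C X A)),
       fib_map = (\<lambda>A \<alpha>. weaken1 P X \<phi> A \<sqinter>\<^bsub>Fib P (Prd C X A)\<^esub>
                         Reidx P (Prd C X A) A (pr2 C X A) \<alpha>) \<rparr>)"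

end

theory Submission
  imports Defs
begin

text \<open>
  The fibre of the Kleisli doctrine over \<open>A\<close> is the principal down-set of the weakening \<open>w\<close>
  of \<open>\<phi>\<close> in the fibre over \<open>X \<times> A\<close>. In such a down-set meets and bottom are inherited, the top is
  \<open>w\<close>, and \<open>w \<and> \<not>a\<close> is the pseudo-complement of \<open>w \<and> a\<close>, since \<open>w \<and> a \<and> b = a \<and> b\<close> for \<open>b \<le> w\<close>.
  Reindexings along \<open>\<langle>pr\<^sub>1, g\<rangle>\<close> fix the weakenings of \<open>\<phi>\<close> and therefore preserve this structure,
  and the canonical arrow is a reindexing followed by \<open>w \<and> _\<close>.
\<close>

section \<open>Principal down-sets\<close>

text \<open>Only the carrier of the record is updated, so the order is inherited and each fibre of
  \<open>kleisli_doctrine\<close> is literally a \<open>down_slice\<close>.\<close>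

definition down_slice :: "'p gorder \<Rightarrow> 'p \<Rightarrow> 'p gorder" where
  "down_slice L w = L\<lparr>carrier := {a \<in> carrier L. a \<sqsubseteq>\<^bsub>L\<^esub> w}\<rparr>"

lemma carrier_down_slice [simp]: "carrier (down_slice L w) = {a \<in> carrier L. a \<sqsubseteq>\<^bsub>L\<^esub> w}"
  and le_down_slice [simp]: "gorder.le (down_slice L w) = gorder.le L"
  and eq_down_slice [simp]: "eq (down_slice L w) = eq L"
  by (simp_all add: down_slice_def)

lemma pneg_eq:
  assumes "partial_order L" "is_pseudo_complement L a c"
  shows "pneg L a = c"
  using assms partial_order.greatest_unique[of L]
  unfolding pneg_def is_pseudo_complement_def by blast

section \<open>Laws of binary meets\<close>

lemma (in lower_semilattice) meet_mono:
  assumes "x \<sqsubseteq> x'" "y \<sqsubseteq> y'" "x \<in> carrier L" "x' \<in> carrier L" "y \<in> carrier L" "y' \<in> carrier L"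
  shows "x \<sqinter> y \<sqsubseteq> x' \<sqinter> y'"
  using assms by (meson le_trans meet_closed meet_le meet_left meet_right)

lemma (in lower_semilattice) meet_assoc:
  assumes "x \<in> carrier L" "y \<in> carrier L" "z \<in> carrier L"
  shows "(x \<sqinter> y) \<sqinter> z = x \<sqinter> (y \<sqinter> z)"
  using weak_meet_assoc[OF assms] by (simp add: eq_is_equal)

lemma (in lower_semilattice) meet_absorb:
  assumes "x \<sqsubseteq> y" "x \<in> carrier L" "y \<in> carrier L"
  shows "x \<sqinter> y = x" "y \<sqinter> x = x"
proof -
  show "x \<sqinter> y = x"
    using assms by (meson le_antisym le_refl meet_closed meet_le meet_left)
  then show "y \<sqinter> x = x"
    by (simp add: meet_comm)
qed

text \<open>By idempotence, the second copy of \<open>w\<close> is absorbed. This is what lets the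
  canonical arrow preserve binary meets.\<close>

lemma (in lower_semilattice) meet_meet_distrib:
  assumes "w \<in> carrier L" "a \<in> carrier L" "b \<in> carrier L"
  shows "w \<sqinter> (a \<sqinter> b) = (w \<sqinter> a) \<sqinter> (w \<sqinter> b)"
proof -
  have "(w \<sqinter> a) \<sqinter> (w \<sqinter> b) = (w \<sqinter> a) \<sqinter> w \<sqinter> b"
    using assms by (simp add: meet_assoc)
  also have "(w \<sqinter> a) \<sqinter> w = w \<sqinter> a"
    using assms by (simp add: meet_absorb meet_left)
  finally show ?thesis
    using assms by (simp add: meet_assoc)
qed

locale principal_down_set = lower_semilattice L for L :: "'p gorder" (structure) +
  fixes w
  assumes w_closed [simp]: "w \<in> carrier L"
begin

lemma partial_order_slice: "partial_order (down_slice L w)"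
  by unfold_locales (auto simp: eq_is_equal intro: le_trans)

text \<open>The meet stays in the slice because it is below \<open>a\<close>, hence below
  \<open>w\<close>; lower bounds in the slice are lower bounds in \<open>L\<close>.\<close>

lemma greatest_meet_slice:
  assumes "a \<in> carrier (down_slice L w)" "b \<in> carrier (down_slice L w)"
  shows "greatest (down_slice L w) (a \<sqinter> b) (Lower (down_slice L w) {a, b})"
  using assms le_trans[OF meet_left]
  by (intro greatest_LowerI) (auto simp: Lower_def meet_left meet_right meet_le)

lemma lower_semilattice_slice: "lower_semilattice (down_slice L w)"
proof -
  interpret S: partial_order "down_slice L w"
    by (rule partial_order_slice)
  show ?thesis
    by unfold_locales (use greatest_meet_slice in blast)
qed

text \<open>The meet of the slice is an element chosen within the slice, so the equality is not
  definitional: it comes from uniqueness of greatest lower bounds.\<close>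

lemma meet_slice:
  assumes "a \<in> carrier (down_slice L w)" "b \<in> carrier (down_slice L w)"
  shows "a \<sqinter>\<^bsub>down_slice L w\<^esub> b = a \<sqinter> b"
proof -
  interpret S: lower_semilattice "down_slice L w"
    by (rule lower_semilattice_slice)
  show ?thesis
    using S.inf_of_two_greatest[OF assms] greatest_meet_slice[OF assms] S.greatest_unique
    unfolding meet_def by blast
qed

lemma top_slice: "weak_partial_order_top (down_slice L w)" "\<top>\<^bsub>down_slice L w\<^esub> = w"
proof -
  interpret S: partial_order "down_slice L w"
    by (rule partial_order_slice)
  have g: "greatest (down_slice L w) w (carrier (down_slice L w))"
    by (auto simp: greatest_def)
  interpret T: weak_partial_order_top "down_slice L w"
    by unfold_locales (use g in blast)
  show "weak_partial_order_top (down_slice L w)" ..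
  show "\<top>\<^bsub>down_slice L w\<^esub> = w"
    using S.greatest_unique[OF T.top_greatest g] .
qed

lemma bottom_slice:
  assumes "weak_partial_order_bottom L"
  shows "weak_partial_order_bottom (down_slice L w)" "\<bottom>\<^bsub>down_slice L w\<^esub> = \<bottom>"
proof -
  interpret B: weak_partial_order_bottom L
    by (rule assms)
  interpret S: partial_order "down_slice L w"
    by (rule partial_order_slice)
  have l: "least (down_slice L w) \<bottom> (carrier (down_slice L w))"
    by (auto simp: least_def)
  interpret T: weak_partial_order_bottom "down_slice L w"
    by unfold_locales (use l in blast)
  show "weak_partial_order_bottom (down_slice L w)" ..
  show "\<bottom>\<^bsub>down_slice L w\<^esub> = \<bottom>"
    using S.least_unique[OF T.bottom_least l] .
qed

text \<open>The slice shares its bottom with \<open>L\<close>, and its elements disjoint from the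
  meet of \<open>w\<close> and \<open>a\<close> are those disjoint from \<open>a\<close> in
  \<open>L\<close>. Hence they lie below both \<open>w\<close> and \<open>c\<close>. Letting
  \<open>a\<close> range over all of \<open>L\<close> covers the image of the canonical arrow as
  well as elements already below \<open>w\<close>.\<close>

lemma is_pseudo_complement_slice:
  assumes B: "weak_partial_order_bottom L"
    and a: "a \<in> carrier L" and c: "is_pseudo_complement L a c"
  shows "is_pseudo_complement (down_slice L w) (w \<sqinter> a) (w \<sqinter> c)"
proof -
  interpret B: weak_partial_order_bottom L
    by (rule B)
  have c': "c \<in> carrier L" "a \<sqinter> c = \<bottom>"
    and max: "\<And>b. b \<in> carrier L \<Longrightarrow> a \<sqinter> b = \<bottom> \<Longrightarrow> b \<sqsubseteq> c"
    using c by (auto simp: is_pseudo_complement_def greatest_def)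
  have meet: "(w \<sqinter> a) \<sqinter>\<^bsub>down_slice L w\<^esub> b = a \<sqinter> b" if "b \<in> carrier L" "b \<sqsubseteq> w" for b
  proof -
    have "(w \<sqinter> a) \<sqinter>\<^bsub>down_slice L w\<^esub> b = a \<sqinter> w \<sqinter> b"
      using that a by (simp add: meet_slice meet_left meet_comm[of L a w])
    then show ?thesis
      using that a by (simp add: meet_assoc meet_absorb)
  qed
  \<comment> \<open>The proposed witness is itself disjoint from \<open>a\<close>: moving
    \<open>w\<close> to the front leaves its meet with bottom.\<close>
  have "a \<sqinter> (w \<sqinter> c) = w \<sqinter> (a \<sqinter> c)"
    using meet_assoc[of a w c] meet_assoc[of w a c] a c'(1) by (simp add: meet_comm[of L a w])
  also have "\<dots> = \<bottom>"
    by (simp add: c' meet_absorb)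
  finally have "(w \<sqinter> a) \<sqinter>\<^bsub>down_slice L w\<^esub> (w \<sqinter> c) = \<bottom>"
    using c' by (simp add: meet meet_left)
  then show ?thesis
    using c' unfolding is_pseudo_complement_def bottom_slice(2)[OF B]
    by (auto simp: greatest_def meet_left meet meet_le max)
qed

lemma pneg_slice:
  assumes "weak_partial_order_bottom L" "a \<in> carrier L" "is_pseudo_complement L a c"
  shows "pneg (down_slice L w) (w \<sqinter> a) = w \<sqinter> pneg L a"
  using pneg_eq[OF partial_order_slice is_pseudo_complement_slice[OF assms]]
    pneg_eq[OF partial_order_axioms assms(3)] by simp

end


section \<open>The Kleisli category\<close>

context fp_category
begin

lemma Prd_in_Obj: "A \<in> Obj C \<Longrightarrow> B \<in> Obj C \<Longrightarrow> Prd C A B \<in> Obj C"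
  and pr1_in_Hom: "A \<in> Obj C \<Longrightarrow> B \<in> Obj C \<Longrightarrow> pr1 C A B \<in> Hom C (Prd C A B) A"
  and pr2_in_Hom: "A \<in> Obj C \<Longrightarrow> B \<in> Obj C \<Longrightarrow> pr2 C A B \<in> Hom C (Prd C A B) B"
  using Prd_product by (auto simp: is_product_def)

lemma pairing:
  assumes "A \<in> Obj C" "B \<in> Obj C" "Z \<in> Obj C" "f \<in> Hom C Z A" "g \<in> Hom C Z B"
  shows pairing_in_Hom: "pairing C Z A B f g \<in> Hom C Z (Prd C A B)"
    and pr1_pairing: "Comp C Z (Prd C A B) A (pr1 C A B) (pairing C Z A B f g) = f"
    and pr2_pairing: "Comp C Z (Prd C A B) B (pr2 C A B) (pairing C Z A B f g) = g"
proof -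
  have "\<exists>!h. h \<in> Hom C Z (Prd C A B) \<and> Comp C Z (Prd C A B) A (pr1 C A B) h = f \<and>
    Comp C Z (Prd C A B) B (pr2 C A B) h = g"
    using assms Prd_product[of A B] by (simp add: is_product_def)
  from theI'[OF this] show "pairing C Z A B f g \<in> Hom C Z (Prd C A B)"
    "Comp C Z (Prd C A B) A (pr1 C A B) (pairing C Z A B f g) = f"
    "Comp C Z (Prd C A B) B (pr2 C A B) (pairing C Z A B f g) = g"
    by (simp_all add: pairing_def)
qed

text \<open>Joint monicity of the projections: \<open>h\<close> and \<open>k\<close> both mediate
  the cone obtained by composing \<open>k\<close> with them.\<close>

lemma Prd_ext:
  assumes "A \<in> Obj C" "B \<in> Obj C" "Z \<in> Obj C"
    and "h \<in> Hom C Z (Prd C A B)" "k \<in> Hom C Z (Prd C A B)"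
    and "Comp C Z (Prd C A B) A (pr1 C A B) h = Comp C Z (Prd C A B) A (pr1 C A B) k"
    and "Comp C Z (Prd C A B) B (pr2 C A B) h = Comp C Z (Prd C A B) B (pr2 C A B) k"
  shows "h = k"
proof -
  have "Comp C Z (Prd C A B) A (pr1 C A B) k \<in> Hom C Z A"
    "Comp C Z (Prd C A B) B (pr2 C A B) k \<in> Hom C Z B"
    using assms by (auto intro!: Comp_in_Hom Prd_in_Obj pr1_in_Hom pr2_in_Hom)
  then have "\<exists>!l. l \<in> Hom C Z (Prd C A B) \<and>
      Comp C Z (Prd C A B) A (pr1 C A B) l = Comp C Z (Prd C A B) A (pr1 C A B) k \<and>
      Comp C Z (Prd C A B) B (pr2 C A B) l = Comp C Z (Prd C A B) B (pr2 C A B) k"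
    using assms(1-3) Prd_product[of A B] by (simp add: is_product_def)
  then show ?thesis
    using assms(4-7) by blast
qed

end

locale kleisli_base = fp_category C for C :: "('o, 'm) fp_category_data" +
  fixes X :: 'o
  assumes X_Obj: "X \<in> Obj C"
begin

abbreviation K :: "('o, 'm) fp_category_data" where "K \<equiv> kleisli_category C X"
abbreviation XP :: "'o \<Rightarrow> 'o" where "XP \<equiv> Prd C X"
abbreviation lift :: "'o \<Rightarrow> 'o \<Rightarrow> 'm \<Rightarrow> 'm" where "lift \<equiv> kleisli_lift C X"

lemma kleisli_simps [simp]:
  "Obj K = Obj C" "Hom K A B = Hom C (XP A) B" "Ide K A = pr2 C X A"
  "Comp K A B D h g = Comp C (XP A) (XP B) D h (lift A B g)"
  "Trm K = Trm C" "Prd K = Prd C"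
  "pr1 K A B = Comp C (XP (Prd C A B)) (Prd C A B) A (pr1 C A B) (pr2 C X (Prd C A B))"
  "pr2 K A B = Comp C (XP (Prd C A B)) (Prd C A B) B (pr2 C A B) (pr2 C X (Prd C A B))"
  by (simp_all add: kleisli_category_def)

lemma XP_Obj [simp]: "A \<in> Obj C \<Longrightarrow> XP A \<in> Obj C"
  and pr1_XP [simp]: "A \<in> Obj C \<Longrightarrow> pr1 C X A \<in> Hom C (XP A) X"
  and pr2_XP [simp]: "A \<in> Obj C \<Longrightarrow> pr2 C X A \<in> Hom C (XP A) A"
  using X_Obj Prd_in_Obj pr1_in_Hom pr2_in_Hom by auto

lemma lift:
  assumes "A \<in> Obj C" "B \<in> Obj C" "g \<in> Hom C (XP A) B"
  shows lift_in_Hom: "lift A B g \<in> Hom C (XP A) (XP B)"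
    and pr1_lift: "Comp C (XP A) (XP B) X (pr1 C X B) (lift A B g) = pr1 C X A"
    and pr2_lift: "Comp C (XP A) (XP B) B (pr2 C X B) (lift A B g) = g"
  using assms X_Obj by (simp_all add: kleisli_lift_def pairing)

text \<open>Both arrows have the same composites with the two projections. With
  \<open>lift_comp\<close> this makes \<open>lift\<close> a functor from \<open>K\<close> to the
  base, sending \<open>A\<close> to \<open>XP A\<close>.\<close>

lemma lift_pr2:
  assumes "A \<in> Obj C"
  shows "lift A A (pr2 C X A) = Ide C (XP A)"
  by (rule Prd_ext[of X A "XP A"])
    (use assms X_Obj in \<open>simp_all add: lift Ide_in_Hom Comp_Ide_right\<close>)

text \<open>After \<open>pr1\<close> both sides give \<open>pr1\<close>, and after
  \<open>pr2\<close> both give the Kleisli composite. Associativity in \<open>K\<close> and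
  functoriality of the Kleisli reindexings rest on this.\<close>

lemma lift_comp:
  assumes "A \<in> Obj C" "B \<in> Obj C" "D \<in> Obj C" "g \<in> Hom C (XP A) B" "h \<in> Hom C (XP B) D"
  shows "lift A D (Comp C (XP A) (XP B) D h (lift A B g)) =
    Comp C (XP A) (XP B) (XP D) (lift B D h) (lift A B g)"
proof -
  have k: "Comp C (XP A) (XP B) D h (lift A B g) \<in> Hom C (XP A) D"
    using assms by (auto intro!: Comp_in_Hom lift_in_Hom)
  show ?thesis
    by (rule Prd_ext[of X D "XP A"])
      (use assms k X_Obj in \<open>simp_all add: lift Comp_in_Hom Comp_assoc\<close>)
qed

text \<open>Since \<open>pr2\<close> cancels against the lift, Kleisli postcomposition with the
  image of a base arrow \<open>f\<close> is ordinary postcomposition with \<open>f\<close>.\<close>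

lemma comp_pr2_lift:
  assumes "A \<in> Obj C" "B \<in> Obj C" "D \<in> Obj C" "g \<in> Hom C (XP A) B" "f \<in> Hom C B D"
  shows "Comp C (XP A) (XP B) D (Comp C (XP B) B D f (pr2 C X B)) (lift A B g) =
    Comp C (XP A) B D f g"
  using assms by (simp add: Comp_assoc[symmetric] lift)

lemma category_kleisli: "category K"
proof
  fix A B D E f g h
  assume "A \<in> Obj K" "B \<in> Obj K" "D \<in> Obj K" "E \<in> Obj K"
    "f \<in> Hom K A B" "g \<in> Hom K B D" "h \<in> Hom K D E"
  then show "Comp K A D E h (Comp K A B D g f) = Comp K A B E (Comp K B D E h g) f"
    by (simp add: lift_comp lift Comp_assoc)
\<comment> \<open>The right identity law is \<open>lift_pr2\<close>; the left one is
  \<open>pr2_lift\<close>.\<close>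
qed (simp_all add: Comp_in_Hom lift lift_pr2 Comp_Ide_right)

text \<open>Kleisli arrows out of \<open>Z\<close> are base arrows out of \<open>XP Z\<close>, so
  terminality is applied at that object.\<close>

lemma is_terminal_kleisli: "is_terminal C T \<Longrightarrow> is_terminal K T"
  by (simp add: is_terminal_def)

text \<open>By \<open>comp_pr2_lift\<close>, the universal property at \<open>Z\<close> in
  \<open>K\<close> is the original one at \<open>XP Z\<close>. An arbitrary product cone is treated,
  to serve both the chosen products of \<open>K\<close> and product preservation by the canonical
  arrow.\<close>

lemma is_product_kleisli:
  assumes "is_product C A B Q p q"
  shows "is_product K A B Q (Comp C (XP Q) Q A p (pr2 C X Q)) (Comp C (XP Q) Q B q (pr2 C X Q))"
proof -
  have *: "A \<in> Obj C" "B \<in> Obj C" "Q \<in> Obj C" "p \<in> Hom C Q A" "q \<in> Hom C Q B"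
    and univ: "\<And>Z f g. \<lbrakk>Z \<in> Obj C; f \<in> Hom C Z A; g \<in> Hom C Z B\<rbrakk> \<Longrightarrow>
      \<exists>!h. h \<in> Hom C Z Q \<and> Comp C Z Q A p h = f \<and> Comp C Z Q B q h = g"
    using assms by (simp_all add: is_product_def)
  have "\<exists>!h. h \<in> Hom K Z Q \<and> Comp K Z Q A (Comp C (XP Q) Q A p (pr2 C X Q)) h = f \<and>
      Comp K Z Q B (Comp C (XP Q) Q B q (pr2 C X Q)) h = g"
    if "Z \<in> Obj C" "f \<in> Hom C (XP Z) A" "g \<in> Hom C (XP Z) B" for Z f g
    using univ[OF XP_Obj, OF that] that * by (simp add: comp_pr2_lift cong: conj_cong)
  with * show ?thesis
    by (simp add: is_product_def Comp_in_Hom)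
qed

lemma fp_category_kleisli: "fp_category K"
proof -
  interpret K: category K
    by (rule category_kleisli)
  show ?thesis
    by unfold_locales
      (use is_terminal_kleisli Trm_terminal is_product_kleisli Prd_product in simp_all)
qed

end


section \<open>The Kleisli doctrine\<close>

locale kleisli_setting = primary_doctrine P for P :: "('o, 'm, 'p) doctrine_data" +
  fixes X :: 'o and \<phi> :: 'p
  assumes X_in_Obj: "X \<in> Obj (Base P)" and \<phi>_closed: "\<phi> \<in> carrier (Fib P X)"
begin

sublocale kleisli_base "Base P" X
  using Base_fp_category X_in_Obj by (simp add: kleisli_base_def kleisli_base_axioms_def)

abbreviation R :: "('o, 'm, 'p) doctrine_data" where "R \<equiv> kleisli_doctrine P X \<phi>"
abbreviation w :: "'o \<Rightarrow> 'p" where "w \<equiv> weaken1 P X \<phi>"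
abbreviation F :: "('o, 'm, 'p, 'o, 'm, 'p) one_arrow_data" where "F \<equiv> kleisli_arrow P X \<phi>"
abbreviation wk2 :: "'o \<Rightarrow> 'p \<Rightarrow> 'p" where "wk2 A \<equiv> Reidx P (XP A) A (pr2 (Base P) X A)"

lemma kleisli_doctrine_simps [simp]:
  "Base R = K"
  "Fib R A = down_slice (Fib P (XP A)) (w A)"
  "Reidx R A B g = Reidx P (XP A) (XP B) (lift A B g)"
  by (simp_all add: kleisli_doctrine_def down_slice_def Let_def)

lemma kleisli_arrow_simps [simp]:
  "ob_map F A = A"
  "ar_map F A B f = Comp (Base P) (XP A) A B f (pr2 (Base P) X A)"
  "fib_map F A a = w A \<sqinter>\<^bsub>Fib P (XP A)\<^esub> wk2 A a"
  by (simp_all add: kleisli_arrow_def Let_def)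

lemma Reidx_in_carrier:
  assumes "A \<in> Obj (Base P)" "B \<in> Obj (Base P)" "f \<in> Hom (Base P) A B" "a \<in> carrier (Fib P B)"
  shows "Reidx P A B f a \<in> carrier (Fib P A)"
  using Reidx_closed[OF assms(1-3)] assms(4) by blast

lemma Reidx_mono:
  assumes "A \<in> Obj (Base P)" "B \<in> Obj (Base P)" "f \<in> Hom (Base P) A B"
    and "a \<in> carrier (Fib P B)" "b \<in> carrier (Fib P B)" "a \<sqsubseteq>\<^bsub>Fib P B\<^esub> b"
  shows "Reidx P A B f a \<sqsubseteq>\<^bsub>Fib P A\<^esub> Reidx P A B f b"
  using use_iso2[OF Reidx_isotone[OF assms(1-3)] assms(4-6)] .

lemma w_in_carrier: "A \<in> Obj (Base P) \<Longrightarrow> w A \<in> carrier (Fib P (XP A))"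
  using X_in_Obj \<phi>_closed by (simp add: weaken1_def Reidx_in_carrier)

lemma wk2_in_carrier:
  "A \<in> Obj (Base P) \<Longrightarrow> a \<in> carrier (Fib P A) \<Longrightarrow> wk2 A a \<in> carrier (Fib P (XP A))"
  by (simp add: Reidx_in_carrier)

lemma principal_down_set_Fib: "A \<in> Obj (Base P) \<Longrightarrow> principal_down_set (Fib P (XP A)) (w A)"
  using Fib_meet[of "XP A"] w_in_carrier
  by (simp add: principal_down_set.intro principal_down_set_axioms.intro)

text \<open>The lift commutes with the projections to \<open>X\<close>, so both sides reindex \<phi>
  along \<open>pr1\<close>. Consequently reindexing restricts to the slices and preserves their
  tops.\<close>

lemma Reidx_w:
  assumes "A \<in> Obj (Base P)" "B \<in> Obj (Base P)" "g \<in> Hom (Base P) (XP A) B"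
  shows "Reidx P (XP A) (XP B) (lift A B g) (w B) = w A"
  using assms X_in_Obj \<phi>_closed unfolding weaken1_def
  by (simp add: lift flip: Reidx_Comp)

text \<open>Monotonicity carries the bound \<open>w B\<close> to its reindexing, which is
  \<open>w A\<close> by \<open>Reidx_w\<close>.\<close>

lemma Reidx_slice_closed:
  assumes "A \<in> Obj (Base P)" "B \<in> Obj (Base P)" "g \<in> Hom (Base P) (XP A) B"
    and "a \<in> carrier (down_slice (Fib P (XP B)) (w B))"
  shows "Reidx P (XP A) (XP B) (lift A B g) a \<in> carrier (down_slice (Fib P (XP A)) (w A))"
  using assms Reidx_mono[of "XP A" "XP B" "lift A B g" a "w B"]
  by (simp add: lift Reidx_w Reidx_in_carrier w_in_carrier)

lemma primary_doctrine_kleisli: "primary_doctrine R"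
proof (intro primary_doctrine.intro doctrine.intro primary_doctrine_axioms.intro)
  show "fp_category (Base R)"
    by (simp add: fp_category_kleisli)
next
  fix A assume A: "A \<in> Obj (Base R)"
  then interpret S: principal_down_set "Fib P (XP A)" "w A"
    by (simp add: principal_down_set_Fib)
  show "partial_order (Fib R A)" "weak_partial_order_top (Fib R A)" "lower_semilattice (Fib R A)"
    by (simp_all add: S.partial_order_slice S.top_slice S.lower_semilattice_slice)
  show "Reidx R A A (Ide (Base R) A) a = a" if "a \<in> carrier (Fib R A)" for a
    using A that by (simp add: lift_pr2 Reidx_Ide)
next
  fix A B f
  assume A: "A \<in> Obj (Base R)" and B: "B \<in> Obj (Base R)" and f: "f \<in> Hom (Base R) A B"
  interpret SA: principal_down_set "Fib P (XP A)" "w A"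
    using A by (simp add: principal_down_set_Fib)
  interpret SB: principal_down_set "Fib P (XP B)" "w B"
    using B by (simp add: principal_down_set_Fib)
  show closed: "Reidx R A B f \<in> carrier (Fib R B) \<rightarrow> carrier (Fib R A)"
    using A B f Reidx_slice_closed[of A B f] by auto
  show "isotone (Fib R B) (Fib R A) (Reidx R A B f)"
    using A B f
    by (intro isotoneI)
      (simp_all add: partial_order.axioms(1) SA.partial_order_slice SB.partial_order_slice
        Reidx_mono lift)
  \<comment> \<open>The tops are \<open>w B\<close> and \<open>w A\<close>, not the tops of the
    fibres of \<open>P\<close>.\<close>
  show "Reidx R A B f \<top>\<^bsub>Fib R B\<^esub> = \<top>\<^bsub>Fib R A\<^esub>"
    using A B f by (simp add: SA.top_slice SB.top_slice Reidx_w)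
  show "Reidx R A B f (a \<sqinter>\<^bsub>Fib R B\<^esub> b) = Reidx R A B f a \<sqinter>\<^bsub>Fib R A\<^esub> Reidx R A B f b"
    if a: "a \<in> carrier (Fib R B)" and b: "b \<in> carrier (Fib R B)" for a b
    using A B f a b Reidx_slice_closed[of A B f]
    by (simp add: SA.meet_slice SB.meet_slice Reidx_meet lift)
next
  fix A B D f g a
  assume "A \<in> Obj (Base R)" "B \<in> Obj (Base R)" "D \<in> Obj (Base R)"
    "f \<in> Hom (Base R) A B" "g \<in> Hom (Base R) B D" "a \<in> carrier (Fib R D)"
  then show "Reidx R A D (Comp (Base R) A B D g f) a = Reidx R A B f (Reidx R B D g a)"
    by (simp add: lift_comp lift Reidx_Comp)
qed

section \<open>The canonical arrow as a primary homomorphism\<close>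

lemma primary_hom_kleisli_arrow: "primary_hom P R F"
proof -
  interpret R: primary_doctrine R
    by (rule primary_doctrine_kleisli)
  show ?thesis
  proof
    fix A assume "A \<in> Obj (Base P)"
    then show "ob_map F A \<in> Obj (Base R)"
      by simp
  next
    fix A B f assume "A \<in> Obj (Base P)" "B \<in> Obj (Base P)" "f \<in> Hom (Base P) A B"
    then show "ar_map F A B f \<in> Hom (Base R) (ob_map F A) (ob_map F B)"
      by (simp add: Comp_in_Hom)
  next
    fix A assume "A \<in> Obj (Base P)"
    then show "ar_map F A A (Ide (Base P) A) = Ide (Base R) (ob_map F A)"
      by (simp add: Comp_Ide_left)
  next
    fix A B D f g
    assume "A \<in> Obj (Base P)" "B \<in> Obj (Base P)" "D \<in> Obj (Base P)"
      "f \<in> Hom (Base P) A B" "g \<in> Hom (Base P) B D"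
    then show "ar_map F A D (Comp (Base P) A B D g f) =
      Comp (Base R) (ob_map F A) (ob_map F B) (ob_map F D) (ar_map F B D g) (ar_map F A B f)"
      by (simp add: comp_pr2_lift Comp_in_Hom Comp_assoc)
  next
    show "is_terminal (Base R) (ob_map F T)" if "is_terminal (Base P) T" for T
      using that by (simp add: is_terminal_kleisli)
    show "is_product (Base R) (ob_map F A) (ob_map F B) (ob_map F Q)
        (ar_map F Q A p) (ar_map F Q B q)" if "is_product (Base P) A B Q p q" for A B Q p q
      using that by (simp add: is_product_kleisli)
  next
    fix A assume A: "A \<in> Obj (Base P)"
    then interpret S: principal_down_set "Fib P (XP A)" "w A"
      by (simp add: principal_down_set_Fib)
    interpret T: weak_partial_order_top "Fib P (XP A)"
      using A by (simp add: Fib_top)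
    have closed: "fib_map F A a \<in> carrier (Fib R A)" if "a \<in> carrier (Fib P A)" for a
      using A that by (simp add: S.meet_left wk2_in_carrier)
    then show "fib_map F A \<in> carrier (Fib P A) \<rightarrow> carrier (Fib R (ob_map F A))"
      by (simp del: kleisli_arrow_simps(3) kleisli_doctrine_simps)
    show "isotone (Fib P A) (Fib R (ob_map F A)) (fib_map F A)"
      using A Fib_partial_order[OF A]
      by (intro isotoneI)
        (simp_all add: partial_order.axioms(1) S.partial_order_slice S.meet_mono Reidx_mono
          wk2_in_carrier)
    show "fib_map F A \<top>\<^bsub>Fib P A\<^esub> = \<top>\<^bsub>Fib R (ob_map F A)\<^esub>"
      using A by (simp add: Reidx_top S.top_slice S.meet_absorb)
    show "fib_map F A (a \<sqinter>\<^bsub>Fib P A\<^esub> b) = fib_map F A a \<sqinter>\<^bsub>Fib R (ob_map F A)\<^esub> fib_map F A b"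
      if "a \<in> carrier (Fib P A)" "b \<in> carrier (Fib P A)" for a b
      using A that closed[of a] closed[of b]
      by (simp add: S.meet_slice Reidx_meet wk2_in_carrier flip: S.meet_meet_distrib)
  next
    fix A B f b
    assume A: "A \<in> Obj (Base P)" and B: "B \<in> Obj (Base P)" and f: "f \<in> Hom (Base P) A B"
      and b: "b \<in> carrier (Fib P B)"
    have k: "Comp (Base P) (XP A) A B f (pr2 (Base P) X A) \<in> Hom (Base P) (XP A) B" (is "?k \<in> _")
      using A B f by (simp add: Comp_in_Hom)
    \<comment> \<open>Both sides reindex \<open>b\<close> along \<open>?k\<close>: on the left
      \<open>pr2\<close> after the lift of \<open>?k\<close> is \<open>?k\<close>, and on the right
      \<open>?k\<close> is \<open>f\<close> after \<open>pr2\<close>. The component \<open>w\<close>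
      is then handled by \<open>Reidx_w\<close>.\<close>
    have "Reidx P (XP A) (XP B) (lift A B ?k) (wk2 B b) = wk2 A (Reidx P A B f b)"
      using A B f b k by (simp add: lift flip: Reidx_Comp)
    then show "fib_map F A (Reidx P A B f b) =
      Reidx R (ob_map F A) (ob_map F B) (ar_map F A B f) (fib_map F B b)"
      using A B f b k by (simp add: Reidx_meet lift w_in_carrier wk2_in_carrier Reidx_w)
  qed
qed

end

section \<open>Pseudo-complements in the Kleisli doctrine\<close>

locale pseudo_complemented_kleisli_setting =
  kleisli_setting P X \<phi> + pseudo_complemented_doctrine P
  for P :: "('o, 'm, 'p) doctrine_data" and X \<phi>
begin

lemma pneg_in_carrier:
  assumes "A \<in> Obj (Base P)" "a \<in> carrier (Fib P A)"
  shows "pneg (Fib P A) a \<in> carrier (Fib P A)"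
  using pseudo_complement_exists[OF assms] pneg_eq[OF Fib_partial_order[OF assms(1)]]
  by (auto simp: is_pseudo_complement_def greatest_def)

lemma pneg_slice_meet:
  assumes "A \<in> Obj (Base P)" "a \<in> carrier (Fib P (XP A))"
  shows "pneg (down_slice (Fib P (XP A)) (w A)) (w A \<sqinter>\<^bsub>Fib P (XP A)\<^esub> a) =
    w A \<sqinter>\<^bsub>Fib P (XP A)\<^esub> pneg (Fib P (XP A)) a"
  using assms pseudo_complement_exists[of "XP A" a]
    principal_down_set.pneg_slice[OF principal_down_set_Fib Fib_bottom] by fastforce

text \<open>An element of the slice equals its meet with \<open>w A\<close>, so this is an instance
  of \<open>pneg_slice_meet\<close>.\<close>

lemma pneg_slice:
  assumes "A \<in> Obj (Base P)" "a \<in> carrier (down_slice (Fib P (XP A)) (w A))"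
  shows "pneg (down_slice (Fib P (XP A)) (w A)) a =
    w A \<sqinter>\<^bsub>Fib P (XP A)\<^esub> pneg (Fib P (XP A)) a"
proof -
  interpret S: principal_down_set "Fib P (XP A)" "w A"
    using assms by (simp add: principal_down_set_Fib)
  show ?thesis
    using pneg_slice_meet[of A a] assms by (simp add: S.meet_absorb)
qed

lemma pseudo_complemented_kleisli: "pseudo_complemented_doctrine R"
proof (intro pseudo_complemented_doctrine.intro pseudo_complemented_doctrine_axioms.intro
    primary_doctrine_kleisli)
  fix A assume A: "A \<in> Obj (Base R)"
  then interpret S: principal_down_set "Fib P (XP A)" "w A"
    by (simp add: principal_down_set_Fib)
  have B: "weak_partial_order_bottom (Fib P (XP A))"
    using A by (simp add: Fib_bottom)
  show "weak_partial_order_bottom (Fib R A)"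
    by (simp add: S.bottom_slice[OF B])
  show "\<exists>c. is_pseudo_complement (Fib R A) a c" if a: "a \<in> carrier (Fib R A)" for a
  proof -
    obtain c where "is_pseudo_complement (Fib P (XP A)) a c"
      using pseudo_complement_exists[of "XP A" a] A a by auto
    then show ?thesis
      using S.is_pseudo_complement_slice[OF B, of a c] a by (auto simp: S.meet_absorb)
  qed
next
  fix A B f
  assume A: "A \<in> Obj (Base R)" and B: "B \<in> Obj (Base R)" and f: "f \<in> Hom (Base R) A B"
  show "Reidx R A B f \<bottom>\<^bsub>Fib R B\<^esub> = \<bottom>\<^bsub>Fib R A\<^esub>"
    using A B f
    by (simp add: principal_down_set.bottom_slice principal_down_set_Fib Fib_bottom Reidx_bottom
        lift)
  \<comment> \<open>Reindexing the meet of \<open>w B\<close> with the negation of \<open>a\<close>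
    in \<open>P\<close> gives the meet of \<open>w A\<close> with the negation of the reindexed
    \<open>a\<close>. The latter lies in the slice over \<open>A\<close>, so
    \<open>pneg_slice\<close> applies again.\<close>
  show "Reidx R A B f (pneg (Fib R B) a) = pneg (Fib R A) (Reidx R A B f a)"
    if a: "a \<in> carrier (Fib R B)" for a
    using A B f a Reidx_slice_closed[of A B f a]
    by (simp add: pneg_slice Reidx_meet Reidx_pneg Reidx_w lift w_in_carrier pneg_in_carrier)
qed

lemma pseudo_complement_preserving_kleisli_arrow: "pseudo_complement_preserving_hom P R F"
proof -
  interpret R: pseudo_complemented_doctrine R
    by (rule pseudo_complemented_kleisli)
  interpret F: primary_hom P R F
    by (rule primary_hom_kleisli_arrow)
  show ?thesis
  proof
    fix A assume A: "A \<in> Obj (Base P)"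
    then interpret S: principal_down_set "Fib P (XP A)" "w A"
      by (simp add: principal_down_set_Fib)
    interpret B: weak_partial_order_bottom "Fib P (XP A)"
      using A by (simp add: Fib_bottom)
    show "fib_map F A \<bottom>\<^bsub>Fib P A\<^esub> = \<bottom>\<^bsub>Fib R (ob_map F A)\<^esub>"
      using A
      by (simp add: Reidx_bottom S.bottom_slice B.weak_partial_order_bottom_axioms S.meet_absorb)
    \<comment> \<open>Negation commutes with \<open>wk2\<close>, whose values need not lie below
      \<open>w A\<close>; hence the version \<open>pneg_slice_meet\<close> for arbitrary elements of
      the fibre.\<close>
    show "fib_map F A (pneg (Fib P A) a) = pneg (Fib R (ob_map F A)) (fib_map F A a)"
      if a: "a \<in> carrier (Fib P A)" for a
      using A a by (simp add: pneg_slice_meet wk2_in_carrier Reidx_pneg)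
  qed
qed

end

theorem proposition5p15:
  fixes P :: "('o, 'm, 'p) doctrine_data" and X :: 'o and \<phi> :: 'p
  assumes "primary_doctrine P"
    and "X \<in> Obj (Base P)"
    and "\<phi> \<in> carrier (Fib P X)"
    and "pseudo_complemented_doctrine P"
  shows "pseudo_complemented_doctrine (kleisli_doctrine P X \<phi>) \<and>
         pseudo_complement_preserving_hom P (kleisli_doctrine P X \<phi>) (kleisli_arrow P X \<phi>)"
proof -
  interpret pseudo_complemented_kleisli_setting P X \<phi>
    using assms
    by (simp add: pseudo_complemented_kleisli_setting_def kleisli_setting_def
        kleisli_setting_axioms_def)
  show ?thesis
    using pseudo_complemented_kleisli pseudo_complement_preserving_kleisli_arrow by blast
qed

end
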